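(* Let $L$ be a pretransitive normal modal logic and $m=\mathrm{tr}(L)$. Then for every modal formula $\varphi$, $$\varphi\in L[1]\iff \Diamond^{\leq m}\Box^{\leq m}\varphi\in L.$$
   Context: Modal formulas are built from variables $p_1,p_2,\dots$, $\bot,\top$, Boolean connectives and unary $\Diamond$; $\Box\varphi=\neg\Diamond\neg\varphi$, $\Diamond^0\varphi=\varphi$, $\Diamond^{i+1}\varphi=\Diamond\Diamond^i\varphi$, $\Box^0\varphi=\varphi$, $\Box^{i+1}\varphi=\Box\Box^i\varphi$, $\Diamond^{\le m}\varphi=\bigvee_{i=0}^m\Diamond^i\varphi$, $\Box^{\le m}\varphi=\bigwedge_{i=0}^m\Box^i\varphi$. A (normal propositional modal) logic is a set of formulas containing all propositional tautologies, $\neg\Diamond\bot$ and $\Diamond(p_1\vee p_2)\to\Diamond p_1\vee\Diamond p_2$, closed under modus ponens, substitution, and the monotonicity rule (from $\varphi\to\psi$ infer $\Diamond\varphi\to\Diamond\psi$). $L+\Phi$ is the smallest logic containing $L\cup\Phi$. A logic $L$ is pretransitive if it contains $\Diamond^{m+1}p\to\Diamond^{\le m}p$ for some $m\ge 0$; $\mathrm{tr}(L)$ is the least such $m$. Formulas $B_h(m)$: $B_1(m)=p_1\to\Box^{\le m}\Diamond^{\le m}p_1$, $B_{h+1}(m)=p_{h+1}\to\Box^{\le m}(\Diamond^{\le m}p_{h+1}\vee B_h(m))$. For pretransitive $L$, $L[h]=L+\{B_h(\mathrm{tr}(L))\}$. *)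

theory Defs
  imports Main
begin

(* Var i is the variable p_(i+1) of the sequence p_1, p_2, ... *)
datatype fm =
    Var nat
  | Bot ("\<^bold>\<bottom>")
  | Top ("\<^bold>\<top>")
  | Neg fm ("\<^bold>\<not> _" [80] 80)
  | And fm fm (infixr "\<^bold>\<and>" 75)
  | Or fm fm (infixr "\<^bold>\<or>" 70)
  | Imp fm fm (infixr "\<^bold>\<longrightarrow>" 65)
  | Dia fm ("\<diamond> _" [80] 80)

definition Box :: "fm \<Rightarrow> fm" ("\<box> _" [80] 80) where
  "\<box> \<phi> = \<^bold>\<not> \<diamond> \<^bold>\<not> \<phi>"

primrec dia_pow :: "nat \<Rightarrow> fm \<Rightarrow> fm" where
  "dia_pow 0 \<phi> = \<phi>"
| "dia_pow (Suc i) \<phi> = \<diamond> (dia_pow i \<phi>)"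

primrec box_pow :: "nat \<Rightarrow> fm \<Rightarrow> fm" where
  "box_pow 0 \<phi> = \<phi>"
| "box_pow (Suc i) \<phi> = \<box> (box_pow i \<phi>)"

primrec dia_le :: "nat \<Rightarrow> fm \<Rightarrow> fm" where
  "dia_le 0 \<phi> = dia_pow 0 \<phi>"
| "dia_le (Suc m) \<phi> = dia_le m \<phi> \<^bold>\<or> dia_pow (Suc m) \<phi>"

primrec box_le :: "nat \<Rightarrow> fm \<Rightarrow> fm" where
  "box_le 0 \<phi> = box_pow 0 \<phi>"
| "box_le (Suc m) \<phi> = box_le m \<phi> \<^bold>\<and> box_pow (Suc m) \<phi>"

primrec subst :: "(nat \<Rightarrow> fm) \<Rightarrow> fm \<Rightarrow> fm" where
  "subst \<sigma> (Var i) = \<sigma> i"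
| "subst \<sigma> \<^bold>\<bottom> = \<^bold>\<bottom>"
| "subst \<sigma> \<^bold>\<top> = \<^bold>\<top>"
| "subst \<sigma> (\<^bold>\<not> \<phi>) = \<^bold>\<not> subst \<sigma> \<phi>"
| "subst \<sigma> (\<phi> \<^bold>\<and> \<psi>) = subst \<sigma> \<phi> \<^bold>\<and> subst \<sigma> \<psi>"
| "subst \<sigma> (\<phi> \<^bold>\<or> \<psi>) = subst \<sigma> \<phi> \<^bold>\<or> subst \<sigma> \<psi>"
| "subst \<sigma> (\<phi> \<^bold>\<longrightarrow> \<psi>) = subst \<sigma> \<phi> \<^bold>\<longrightarrow> subst \<sigma> \<psi>"
| "subst \<sigma> (\<diamond> \<phi>) = \<diamond> (subst \<sigma> \<phi>)"

(* Formulas beginning with \<diamond> are propositional atoms for v, so tautologies include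
   the modal substitution instances of modality-free tautologies.  Logics are closed
   under substitution, so it makes no difference which of the two sets is required. *)
primrec prop_eval :: "(fm \<Rightarrow> bool) \<Rightarrow> fm \<Rightarrow> bool" where
  "prop_eval v (Var i) = v (Var i)"
| "prop_eval v \<^bold>\<bottom> = False"
| "prop_eval v \<^bold>\<top> = True"
| "prop_eval v (\<^bold>\<not> \<phi>) = (\<not> prop_eval v \<phi>)"
| "prop_eval v (\<phi> \<^bold>\<and> \<psi>) = (prop_eval v \<phi> \<and> prop_eval v \<psi>)"
| "prop_eval v (\<phi> \<^bold>\<or> \<psi>) = (prop_eval v \<phi> \<or> prop_eval v \<psi>)"
| "prop_eval v (\<phi> \<^bold>\<longrightarrow> \<psi>) = (prop_eval v \<phi> \<longrightarrow> prop_eval v \<psi>)"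
| "prop_eval v (\<diamond> \<phi>) = v (\<diamond> \<phi>)"

definition tautology :: "fm \<Rightarrow> bool" where
  "tautology \<phi> \<longleftrightarrow> (\<forall>v. prop_eval v \<phi>)"

definition modal_logic :: "fm set \<Rightarrow> bool" where
  "modal_logic L \<longleftrightarrow>
     (\<forall>\<phi>. tautology \<phi> \<longrightarrow> \<phi> \<in> L) \<and>
     \<^bold>\<not> \<diamond> \<^bold>\<bottom> \<in> L \<and>
     (\<diamond> (Var 0 \<^bold>\<or> Var 1) \<^bold>\<longrightarrow> \<diamond> (Var 0) \<^bold>\<or> \<diamond> (Var 1)) \<in> L \<and>
     (\<forall>\<phi> \<psi>. \<phi> \<in> L \<longrightarrow> (\<phi> \<^bold>\<longrightarrow> \<psi>) \<in> L \<longrightarrow> \<psi> \<in> L) \<and>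
     (\<forall>\<phi> \<sigma>. \<phi> \<in> L \<longrightarrow> subst \<sigma> \<phi> \<in> L) \<and>
     (\<forall>\<phi> \<psi>. (\<phi> \<^bold>\<longrightarrow> \<psi>) \<in> L \<longrightarrow> (\<diamond> \<phi> \<^bold>\<longrightarrow> \<diamond> \<psi>) \<in> L)"

definition logic_plus :: "fm set \<Rightarrow> fm set \<Rightarrow> fm set" where
  "logic_plus L \<Phi> = \<Inter> {M. modal_logic M \<and> L \<union> \<Phi> \<subseteq> M}"

lemma modal_logic_logic_plus: "modal_logic (logic_plus L \<Phi>)"
  unfolding logic_plus_def modal_logic_def by blast

lemma logic_plus_superset: "L \<union> \<Phi> \<subseteq> logic_plus L \<Phi>"
  unfolding logic_plus_def by blast

lemma logic_plus_least: "modal_logic M \<Longrightarrow> L \<union> \<Phi> \<subseteq> M \<Longrightarrow> logic_plus L \<Phi> \<subseteq> M"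
  unfolding logic_plus_def by blast

definition pretransitive :: "fm set \<Rightarrow> bool" where
  "pretransitive L \<longleftrightarrow> (\<exists>m. (dia_pow (m + 1) (Var 0) \<^bold>\<longrightarrow> dia_le m (Var 0)) \<in> L)"

definition tr :: "fm set \<Rightarrow> nat" where
  "tr L = (LEAST m. (dia_pow (m + 1) (Var 0) \<^bold>\<longrightarrow> dia_le m (Var 0)) \<in> L)"

(* Only h \<ge> 1 is meaningful; height_fm 0 m is left unspecified. *)
fun height_fm :: "nat \<Rightarrow> nat \<Rightarrow> fm" where
  "height_fm (Suc 0) m = Var 0 \<^bold>\<longrightarrow> box_le m (dia_le m (Var 0))"
| "height_fm (Suc (Suc h)) m =
     Var (Suc h) \<^bold>\<longrightarrow> box_le m (dia_le m (Var (Suc h)) \<^bold>\<or> height_fm (Suc h) m)"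

definition height_ext :: "fm set \<Rightarrow> nat \<Rightarrow> fm set" where
  "height_ext L h = logic_plus L {height_fm h (tr L)}"

end

(* Write D for \<diamond>^(\<le>m) and C \<phi> for D \<not> D \<not> \<phi>, which is equivalent to \<diamond>^(\<le>m) \<box>^(\<le>m) \<phi>.
   By pretransitivity D is an S4 diamond over L with \<diamond> \<phi> below D \<phi>, and this makes
   {\<phi>. C \<phi> \<in> L} a normal logic that contains L and B_1(m), hence L[1].
   Conversely, B_1(m) at \<not> \<phi> is the contrapositive of C \<phi> \<longrightarrow> \<phi>. *)
theory Submission
  imports Defs
begin

section \<open>Substitution and iterated modalities\<close>

lemma subst_dia_pow [simp]: "subst \<sigma> (dia_pow n a) = dia_pow n (subst \<sigma> a)"
  by (induction n) simp_all

lemma subst_dia_le [simp]: "subst \<sigma> (dia_le n a) = dia_le n (subst \<sigma> a)"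
  by (induction n) simp_all

lemma subst_box_pow [simp]: "subst \<sigma> (box_pow n a) = box_pow n (subst \<sigma> a)"
  by (induction n) (simp_all add: Box_def)

lemma subst_box_le [simp]: "subst \<sigma> (box_le n a) = box_le n (subst \<sigma> a)"
  by (induction n) (simp_all add: Box_def)

section \<open>Derived rules of a normal logic\<close>

locale normal_logic =
  fixes L :: "fm set"
  assumes modal_logic: "modal_logic L"
begin

abbreviation entails :: "fm \<Rightarrow> fm \<Rightarrow> bool" (infix "\<turnstile>" 50) where
  "a \<turnstile> b \<equiv> (a \<^bold>\<longrightarrow> b) \<in> L"

lemma taut: "(\<And>v. prop_eval v a) \<Longrightarrow> a \<in> L"
  using modal_logic by (simp add: modal_logic_def tautology_def)

lemma mp: "a \<in> L \<Longrightarrow> a \<turnstile> b \<Longrightarrow> b \<in> L"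
  using modal_logic unfolding modal_logic_def by blast

lemma subst_mem: "a \<in> L \<Longrightarrow> subst \<sigma> a \<in> L"
  using modal_logic unfolding modal_logic_def by blast

lemma dia_mono: "a \<turnstile> b \<Longrightarrow> \<diamond> a \<turnstile> \<diamond> b"
  using modal_logic unfolding modal_logic_def by blast

lemma dia_bot: "\<^bold>\<not> \<diamond> \<^bold>\<bottom> \<in> L"
  using modal_logic unfolding modal_logic_def by blast

text \<open>Propositional steps are delegated to truth tables: \<open>prop_eval\<close> treats
  formulas that begin with a diamond as atoms, so a semantic consequence of members of
  \<open>L\<close> is reached by \<open>mp\<close> from a tautology.\<close>

lemma prop1:
  assumes "a \<in> L" and "\<And>v. prop_eval v a \<Longrightarrow> prop_eval v c"
  shows "c \<in> L"
  by (rule mp[OF assms(1)], rule taut) (simp add: assms(2))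

lemma prop2:
  assumes "a \<in> L" "b \<in> L" and "\<And>v. prop_eval v a \<Longrightarrow> prop_eval v b \<Longrightarrow> prop_eval v c"
  shows "c \<in> L"
  by (rule mp[OF assms(1)], rule prop1[OF assms(2)]) (simp add: assms(3))

lemma prop3:
  assumes "a \<in> L" "b \<in> L" "c \<in> L"
    and "\<And>v. prop_eval v a \<Longrightarrow> prop_eval v b \<Longrightarrow> prop_eval v c \<Longrightarrow> prop_eval v d"
  shows "d \<in> L"
  by (rule mp[OF assms(1)], rule prop2[OF assms(2,3)]) (simp add: assms(4))

lemma entails_refl: "a \<turnstile> a"
  by (rule taut) simp

lemma entails_trans [trans]: "a \<turnstile> b \<Longrightarrow> b \<turnstile> c \<Longrightarrow> a \<turnstile> c"
  by (erule (1) prop2) auto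

lemma contrapos: "a \<turnstile> b \<Longrightarrow> \<^bold>\<not> b \<turnstile> \<^bold>\<not> a"
  by (erule prop1) auto

lemma dia_or: "\<diamond> (a \<^bold>\<or> b) \<turnstile> \<diamond> a \<^bold>\<or> \<diamond> b"
proof -
  have "(\<diamond> (Var 0 \<^bold>\<or> Var 1) \<^bold>\<longrightarrow> \<diamond> (Var 0) \<^bold>\<or> \<diamond> (Var 1)) \<in> L"
    using modal_logic unfolding modal_logic_def by blast
  from subst_mem[OF this, of "\<lambda>i. if i = 0 then a else b"] show ?thesis by simp
qed

text \<open>Axiom K in diamond form: a successor satisfying \<open>a\<close> either satisfies
  \<open>b\<close> or refutes the implication.\<close>

lemma dia_imp: "\<diamond> a \<turnstile> \<diamond> b \<^bold>\<or> \<diamond> (\<^bold>\<not> (a \<^bold>\<longrightarrow> b))"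
proof -
  have "a \<turnstile> b \<^bold>\<or> \<^bold>\<not> (a \<^bold>\<longrightarrow> b)" by (rule taut) simp
  from dia_mono[OF this] dia_or show ?thesis by (rule entails_trans)
qed

section \<open>Iterated and bounded diamonds\<close>

lemma dia_pow_mono: "a \<turnstile> b \<Longrightarrow> dia_pow n a \<turnstile> dia_pow n b"
  by (induction n) (simp_all add: dia_mono)

lemma dia_pow_or: "dia_pow n (a \<^bold>\<or> b) \<turnstile> dia_pow n a \<^bold>\<or> dia_pow n b"
proof (induction n)
  case 0
  show ?case by (simp add: entails_refl)
next
  case (Suc n)
  from dia_mono[OF this] dia_or have
    "\<diamond> (dia_pow n (a \<^bold>\<or> b)) \<turnstile> \<diamond> (dia_pow n a) \<^bold>\<or> \<diamond> (dia_pow n b)"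
    by (rule entails_trans)
  then show ?case by simp
qed

lemma dia_pow_bot: "\<^bold>\<not> dia_pow n \<^bold>\<bottom> \<in> L"
proof (induction n)
  case 0
  show ?case by (rule taut) simp
next
  case (Suc n)
  have "dia_pow n \<^bold>\<bottom> \<turnstile> \<^bold>\<bottom>" using Suc by (rule prop1) simp
  from dia_mono[OF this] dia_bot show ?case by (rule prop2) simp
qed

lemma dia_le_mono: "a \<turnstile> b \<Longrightarrow> dia_le n a \<turnstile> dia_le n b"
proof (induction n)
  case 0
  then show ?case by simp
next
  case (Suc n)
  show ?case using Suc.IH[OF Suc.prems] dia_pow_mono[OF Suc.prems, of "Suc n"]
    by (rule prop2) auto
qed

lemma dia_le_or: "dia_le n (a \<^bold>\<or> b) \<turnstile> dia_le n a \<^bold>\<or> dia_le n b"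
proof (induction n)
  case 0
  show ?case by (simp add: entails_refl)
next
  case (Suc n)
  show ?case using Suc dia_pow_or[of "Suc n" a b]
    by (rule prop2) auto
qed

lemma dia_le_bot: "\<^bold>\<not> dia_le n \<^bold>\<bottom> \<in> L"
proof (induction n)
  case 0
  show ?case by (rule taut) simp
next
  case (Suc n)
  show ?case using Suc dia_pow_bot[of "Suc n"] by (rule prop2) auto
qed

lemma dia_le_refl: "a \<turnstile> dia_le n a"
proof (induction n)
  case 0
  show ?case by (simp add: entails_refl)
next
  case (Suc n)
  then show ?case by (rule prop1) auto
qed

lemma dia_pow_dia_le: "i \<le> n \<Longrightarrow> dia_pow i a \<turnstile> dia_le n a"
proof (induction n)
  case 0
  then show ?case by (simp add: entails_refl)
next
  case (Suc n)
  show ?case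
  proof (cases "i = Suc n")
    case True
    show ?thesis unfolding True by (rule taut) simp
  next
    case False
    with Suc have "dia_pow i a \<turnstile> dia_le n a" by simp
    then show ?thesis by (rule prop1) auto
  qed
qed

text \<open>Necessitation for the bounded box, written as a negated diamond. It comes from
  monotonicity, because the negation of a theorem entails falsum.\<close>

lemma dia_le_nec:
  assumes "a \<in> L"
  shows "\<^bold>\<not> dia_le n (\<^bold>\<not> a) \<in> L"
proof -
  have "\<^bold>\<not> a \<turnstile> \<^bold>\<bottom>" using assms by (rule prop1) simp
  from dia_le_mono[OF this, of n] dia_le_bot[of n] show ?thesis by (rule prop2) simp
qed

lemma dia_le_and: "dia_le n a \<^bold>\<and> \<^bold>\<not> dia_le n (\<^bold>\<not> b) \<turnstile> dia_le n (a \<^bold>\<and> b)"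
proof -
  have "a \<turnstile> (a \<^bold>\<and> b) \<^bold>\<or> \<^bold>\<not> b" by (rule taut) simp
  from dia_le_mono[OF this, of n] dia_le_or[of n "a \<^bold>\<and> b" "\<^bold>\<not> b"]
  show ?thesis by (rule prop2) auto
qed

text \<open>Not a tautology: unfolding \<open>box_pow\<close> leaves double negations between
  consecutive diamonds, and each must be removed beneath a diamond by
  \<open>dia_mono\<close>.\<close>

lemma box_pow_dual: "box_pow n a \<turnstile> \<^bold>\<not> dia_pow n (\<^bold>\<not> a)" "\<^bold>\<not> dia_pow n (\<^bold>\<not> a) \<turnstile> box_pow n a"
proof (induction n)
  case 0
  { case 1 show ?case by (rule taut) simp }
  { case 2 show ?case by (rule taut) simp }
next
  case (Suc n)
  have "dia_pow n (\<^bold>\<not> a) \<turnstile> \<^bold>\<not> box_pow n a" using Suc(1) by (rule prop1) auto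
  from dia_mono[OF this]
  have "box_pow (Suc n) a \<turnstile> \<^bold>\<not> dia_pow (Suc n) (\<^bold>\<not> a)" by (rule prop1) (auto simp: Box_def)
  moreover
  have "\<^bold>\<not> box_pow n a \<turnstile> dia_pow n (\<^bold>\<not> a)" using Suc(2) by (rule prop1) auto
  from dia_mono[OF this]
  have "\<^bold>\<not> dia_pow (Suc n) (\<^bold>\<not> a) \<turnstile> box_pow (Suc n) a" by (rule prop1) (auto simp: Box_def)
  ultimately show "box_pow (Suc n) a \<turnstile> \<^bold>\<not> dia_pow (Suc n) (\<^bold>\<not> a)"
    and "\<^bold>\<not> dia_pow (Suc n) (\<^bold>\<not> a) \<turnstile> box_pow (Suc n) a" .
qed

lemma box_le_dual: "box_le n a \<turnstile> \<^bold>\<not> dia_le n (\<^bold>\<not> a)" "\<^bold>\<not> dia_le n (\<^bold>\<not> a) \<turnstile> box_le n a"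
proof (induction n)
  case 0
  { case 1 show ?case by (rule taut) simp }
  { case 2 show ?case by (rule taut) simp }
next
  case (Suc n)
  { case 1 show ?case using Suc(1) box_pow_dual(1)[of "Suc n"] by (rule prop2) auto }
  { case 2 show ?case using Suc(2) box_pow_dual(2)[of "Suc n"] by (rule prop2) auto }
qed

end

section \<open>Pretransitivity: \<open>D\<close> as an S4 diamond\<close>

locale pretransitive_logic = normal_logic +
  fixes m :: nat
  assumes pretrans: "(dia_pow (m + 1) (Var 0) \<^bold>\<longrightarrow> dia_le m (Var 0)) \<in> L"
begin

abbreviation D :: "fm \<Rightarrow> fm" where
  "D \<equiv> dia_le m"

lemma dia_pow_le_D:
  assumes "i \<le> Suc m"
  shows "dia_pow i a \<turnstile> D a"
proof (cases "i = Suc m")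
  case True
  then show ?thesis using subst_mem[OF pretrans, of "\<lambda>_. a"] by simp
next
  case False
  with assms show ?thesis by (simp add: dia_pow_dia_le)
qed

lemma dia_le_D: "\<diamond> a \<turnstile> D a"
  using dia_pow_le_D[of 1] by simp

lemma dia_D: "\<diamond> (D a) \<turnstile> D a"
proof -
  \<comment> \<open>The induction runs over partial disjunctions with \<open>m\<close> fixed in
    \<open>D\<close>. An extra diamond turns exponent \<open>k \<le> m\<close> into at most
    \<open>Suc m\<close>, which is just what \<open>dia_pow_le_D\<close> covers.\<close>
  have "\<diamond> (dia_le k a) \<turnstile> D a" if "k \<le> m" for k
    using that
  proof (induction k)
    case 0
    show ?case by (simp add: dia_le_D)
  next
    case (Suc k)
    then have "\<diamond> (dia_le k a) \<turnstile> D a" by simp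
    from this dia_pow_le_D[of "Suc (Suc k)" a] dia_or[of "dia_le k a" "dia_pow (Suc k) a"]
    show ?case by (rule prop3) (use Suc.prems in auto)
  qed
  then show ?thesis by simp
qed

lemma D_idem: "D (D a) \<turnstile> D a"
proof -
  \<comment> \<open>By \<open>dia_D\<close>, diamonds in front of \<open>D a\<close> are absorbed
    one at a time, so no bound on \<open>k\<close> is required.\<close>
  have pow: "dia_pow k (D a) \<turnstile> D a" for k
  proof (induction k)
    case 0
    show ?case by (simp add: entails_refl)
  next
    case (Suc k)
    from dia_mono[OF this] dia_D have "\<diamond> (dia_pow k (D a)) \<turnstile> D a" by (rule entails_trans)
    then show ?case by simp
  qed
  have "dia_le k (D a) \<turnstile> D a" for k
  proof (induction k)
    case 0
    show ?case by (simp add: entails_refl)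
  next
    case (Suc k)
    from this pow[of "Suc k"] show ?case by (rule prop2) auto
  qed
  then show ?thesis .
qed

section \<open>The operator \<open>C\<close> and the logic it determines\<close>

definition C :: "fm \<Rightarrow> fm" where
  "C a = D (\<^bold>\<not> D (\<^bold>\<not> a))"

lemma C_iff: "D (box_le m a) \<in> L \<longleftrightarrow> C a \<in> L"
  unfolding C_def using dia_le_mono[OF box_le_dual(1)] dia_le_mono[OF box_le_dual(2)] mp by blast

lemma C_mono:
  assumes "a \<turnstile> b"
  shows "C a \<turnstile> C b"
  unfolding C_def by (intro dia_le_mono contrapos assms)

lemma C_mem: "a \<in> L \<Longrightarrow> C a \<in> L"
  unfolding C_def using dia_le_nec dia_le_refl mp by blast

text \<open>In a preorder, \<open>C a\<close> says that some point above has \<open>a\<close>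
  throughout its upward cone. The cones for \<open>a\<close> and for the implication may be disjoint
  at a given point, so the rule relies on \<open>C a\<close> being a theorem: it then also holds
  inside the cone of the implication.\<close>

lemma C_mp:
  assumes "C a \<in> L" "C (a \<^bold>\<longrightarrow> b) \<in> L"
  shows "C b \<in> L"
proof -
  define \<alpha> \<beta> \<gamma> where "\<alpha> = \<^bold>\<not> D (\<^bold>\<not> a)" and "\<beta> = \<^bold>\<not> D (\<^bold>\<not> (a \<^bold>\<longrightarrow> b))" and "\<gamma> = \<^bold>\<not> D (\<^bold>\<not> b)"
  have "\<^bold>\<not> b \<turnstile> \<^bold>\<not> a \<^bold>\<or> \<^bold>\<not> (a \<^bold>\<longrightarrow> b)" by (rule taut) simp
  from dia_le_mono[OF this, of m] dia_le_or[of m "\<^bold>\<not> a" "\<^bold>\<not> (a \<^bold>\<longrightarrow> b)"]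
  have "\<alpha> \<^bold>\<and> \<beta> \<turnstile> \<gamma>" unfolding \<alpha>_def \<beta>_def \<gamma>_def by (rule prop2) auto
  from dia_le_and this[THEN dia_le_mono]
  have "D \<alpha> \<^bold>\<and> \<^bold>\<not> D (\<^bold>\<not> \<beta>) \<turnstile> D \<gamma>" by (rule entails_trans)
  \<comment> \<open>\<beta> persists upwards: by \<open>D_idem\<close> it entails its own
    \<open>D\<close>-box. This supplies the second conjunct needed to combine it with
    \<alpha>.\<close>
  moreover have "\<^bold>\<not> \<beta> \<turnstile> D (\<^bold>\<not> (a \<^bold>\<longrightarrow> b))" unfolding \<beta>_def by (rule taut) simp
  from dia_le_mono[OF this] D_idem have "D (\<^bold>\<not> \<beta>) \<turnstile> D (\<^bold>\<not> (a \<^bold>\<longrightarrow> b))" by (rule entails_trans)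
  moreover have "D \<alpha> \<in> L" using assms(1) by (simp add: C_def \<alpha>_def)
  ultimately have "\<beta> \<turnstile> D \<gamma>" by (rule prop3) (auto simp: \<beta>_def)
  from dia_le_mono[OF this] D_idem have "D \<beta> \<turnstile> D \<gamma>" by (rule entails_trans)
  with assms(2) show ?thesis unfolding C_def \<beta>_def \<gamma>_def by (rule mp)
qed

text \<open>If \<open>\<diamond> a\<close> holds and \<open>\<diamond> b\<close> fails, some
  successor refutes the implication from \<open>a\<close> to \<open>b\<close>. Hence a cone on which
  that implication holds throughout also satisfies the implication between the diamonds.\<close>

lemma C_dia_mono:
  assumes "C (a \<^bold>\<longrightarrow> b) \<in> L"
  shows "C (\<diamond> a \<^bold>\<longrightarrow> \<diamond> b) \<in> L"
proof -
  have "\<^bold>\<not> (\<diamond> a \<^bold>\<longrightarrow> \<diamond> b) \<turnstile> D (\<^bold>\<not> (a \<^bold>\<longrightarrow> b))"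
    using dia_imp[of a b] dia_le_D[of "\<^bold>\<not> (a \<^bold>\<longrightarrow> b)"] by (rule prop2) auto
  from dia_le_mono[OF this] D_idem
  have "D (\<^bold>\<not> (\<diamond> a \<^bold>\<longrightarrow> \<diamond> b)) \<turnstile> D (\<^bold>\<not> (a \<^bold>\<longrightarrow> b))" by (rule entails_trans)
  from dia_le_mono[OF contrapos[OF this]] assms show ?thesis
    unfolding C_def using mp by blast
qed

lemma C_height_one: "C (a \<^bold>\<longrightarrow> box_le m (D a)) \<in> L"
proof -
  \<comment> \<open>q expresses failure of B_1 at \<open>a\<close>, with the outer bounded box
    replaced by its dual, so the goal becomes \<open>D\<close> of the negation of
    \<open>D q\<close>.\<close>
  define q where "q = \<^bold>\<not> (a \<^bold>\<longrightarrow> \<^bold>\<not> D (\<^bold>\<not> D a))"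
  have "q \<turnstile> a" unfolding q_def by (rule taut) simp
  then have qa: "D (\<^bold>\<not> D a) \<turnstile> D (\<^bold>\<not> D q)" by (intro dia_le_mono contrapos)
  have "q \<turnstile> D (\<^bold>\<not> D a)" unfolding q_def by (rule taut) simp
  from dia_le_mono[OF this] D_idem have "D q \<turnstile> D (\<^bold>\<not> D a)" by (rule entails_trans)
  \<comment> \<open>Case split on \<open>D q\<close>. If it holds, a point with no \<open>a\<close>
    above it is reachable, and no q lies above that point. If it fails, the present point is the
    witness by reflexivity.\<close>
  from this qa dia_le_refl have "D (\<^bold>\<not> D q) \<in> L" by (rule prop3) auto
  then have "C (a \<^bold>\<longrightarrow> \<^bold>\<not> D (\<^bold>\<not> D a)) \<in> L" by (simp add: C_def q_def)
  moreover have "a \<^bold>\<longrightarrow> \<^bold>\<not> D (\<^bold>\<not> D a) \<turnstile> a \<^bold>\<longrightarrow> box_le m (D a)"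
    using box_le_dual(2) by (rule prop1) auto
  ultimately show ?thesis using C_mono mp by blast
qed

lemma modal_logic_C: "modal_logic {a. C a \<in> L}"
proof -
  have "C (subst \<sigma> a) = subst \<sigma> (C a)" for \<sigma> a
    by (simp add: C_def)
  then have "C a \<in> L \<Longrightarrow> C (subst \<sigma> a) \<in> L" for \<sigma> a
    by (simp add: subst_mem)
  then show ?thesis
    unfolding modal_logic_def mem_Collect_eq
    using C_mem C_mp C_dia_mono dia_bot dia_or taut unfolding tautology_def by blast
qed

lemma height_one_subset:
  "logic_plus L {height_fm 1 m} \<subseteq> {a. C a \<in> L}"
  by (rule logic_plus_least[OF modal_logic_C]) (use C_mem C_height_one in auto)

end

theorem theorem3:
  fixes L :: "fm set" and m :: nat and \<phi> :: fm
  assumes "modal_logic L"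
    and "pretransitive L"
    and "m = tr L"
  shows "\<phi> \<in> height_ext L 1 \<longleftrightarrow> dia_le m (box_le m \<phi>) \<in> L"
proof -
  interpret pretransitive_logic L m
  proof
    show "modal_logic L" by fact
    show "(dia_pow (m + 1) (Var 0) \<^bold>\<longrightarrow> dia_le m (Var 0)) \<in> L"
      \<comment> \<open>Pretransitivity supplies the witness that makes the \<open>LEAST\<close> in
        \<open>tr\<close> attained.\<close>
      using assms(2) unfolding assms(3) pretransitive_def tr_def by (rule LeastI_ex)
  qed
  define M where "M = logic_plus L {height_fm 1 m}"
  interpret M: normal_logic M
    unfolding M_def by unfold_locales (rule modal_logic_logic_plus)
  have LM: "L \<subseteq> M" and B1: "height_fm 1 m \<in> M"
    using logic_plus_superset unfolding M_def by blast+
  have "\<phi> \<in> M \<longleftrightarrow> D (box_le m \<phi>) \<in> L"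
  proof
    assume "\<phi> \<in> M"
    then show "D (box_le m \<phi>) \<in> L"
      using height_one_subset unfolding M_def C_iff by blast
  next
    assume "D (box_le m \<phi>) \<in> L"
    then have "D (\<^bold>\<not> D (\<^bold>\<not> \<phi>)) \<in> M"
      using LM unfolding C_iff C_def by blast
    moreover have "(\<^bold>\<not> \<phi> \<^bold>\<longrightarrow> box_le m (D (\<^bold>\<not> \<phi>))) \<in> M"
      using M.subst_mem[OF B1, of "\<lambda>_. \<^bold>\<not> \<phi>"] by simp
    \<comment> \<open>Duality turns the conclusion of this instance of B_1 into the negation of
      \<open>C \<phi>\<close>, which is refuted in \<open>M\<close>; the rest is
      propositional.\<close>
    moreover note M.box_le_dual(1)[of m "D (\<^bold>\<not> \<phi>)"]
    ultimately show "\<phi> \<in> M"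
      by (rule M.prop3) auto
  qed
  then show ?thesis by (simp only: height_ext_def M_def assms(3))
qed

end
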